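(* Let $X$ and $Y$ be two infinite-dimensional Banach spaces. Assume that $X$ is crudely finitely representable in the finite-codimensional subspaces of $Y$. Let $M$ be a proper subset of $X$. Then $M$ almost bi-Lipschitz embeds into $Y$.
   Context: Let $C>1$. For infinite-dimensional Banach spaces $X$ and $W$, $X$ is $C$-crudely finitely representable ($C$-c.f.r.) in $W$ if for every finite-dimensional subspace $E$ of $X$ there is a linear isomorphism $T$ from $E$ onto a subspace $T(E)\subset W$ with $\|T\|\cdot\|T^{-1}\|<C$. $X$ is crudely finitely representable in the finite-codimensional subspaces of $Y$ if there exists a constant $C>1$ such that for every $Z\in\mathrm{cof}(Y)$, $X$ is $C$-c.f.r. in $Z$ (the constant $C$ is uniform over $Z$). Here $\mathrm{cof}(Y)$ denotes the set of closed finite-codimensional subspaces of $Y$. A proper subset of $X$ is a subset $M\subset X$ which, as a metric space with the metric induced by the norm of $X$, has the property that all its closed balls are compact. Let $(M,d)$ and $(N,\delta)$ be metric spaces. $M$ is almost bi-Lipschitz embeddable into $N$ (equivalently, $M$ almost bi-Lipschitz embeds into $N$) if for every $A\in(0,\infty)$ there exist a scaling factor $r\in(0,\infty)$ and a constant $D\in[1,\infty)$ such that for every continuous function $\varphi:[0,\infty)\to[0,1)$ with $\varphi(0)=0$ and $\varphi(t)>0$ for all $t>0$, there exists a map $f_\varphi:M\to N$ such that for all $x,y\in M$, $$\varphi(d(x,y))\,r\,d(x,y)\le \delta(f_\varphi(x),f_\varphi(y))\le D\,r\,d(x,y)+A.$$ Banach spaces are equipped with the metric given by the norm. *)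

theory Defs
  imports "HOL-Analysis.Analysis"
begin

definition fin_dim :: "'a::real_vector set \<Rightarrow> bool" where
  "fin_dim V \<longleftrightarrow> (\<exists>B. finite B \<and> B \<subseteq> V \<and> V \<subseteq> span B)"

text \<open>Finite codimension of \<open>Z\<close> in \<open>Y\<close>, i.e. \<open>Y / Z\<close> is finite-dimensional, is expressed by
  adjoining finitely many vectors of \<open>Y\<close> to \<open>Z\<close> to span \<open>Y\<close>.\<close>

definition cof :: "'a::real_normed_vector set \<Rightarrow> 'a set set" where
  "cof Y = {Z. subspace Z \<and> Z \<subseteq> Y \<and> closedin (top_of_set Y) Z \<and>
     (\<exists>B. finite B \<and> B \<subseteq> Y \<and> Y \<subseteq> span (Z \<union> B))}"

definition linear_map_on ::
    "'a::real_vector set \<Rightarrow> ('a \<Rightarrow> 'b::real_vector) \<Rightarrow> bool" where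
  "linear_map_on E T \<longleftrightarrow>
     (\<forall>x\<in>E. \<forall>y\<in>E. T (x + y) = T x + T y) \<and> (\<forall>c. \<forall>x\<in>E. T (c *\<^sub>R x) = c *\<^sub>R T x)"

text \<open>Operator norm of a linear map defined on the subspace \<open>E\<close> only, in the style of
  \<^const>\<open>onorm\<close>. The point \<open>0\<close> contributes \<open>0 / 0 = 0\<close>. The supremum is meaningful only when
  the set of quotients is bounded above, which is automatic for linear maps on
  finite-dimensional \<open>E\<close>, the only case used below.\<close>

definition onorm_on ::
    "'a::real_normed_vector set \<Rightarrow> ('a \<Rightarrow> 'b::real_normed_vector) \<Rightarrow> real" where
  "onorm_on E T = (SUP x\<in>E. norm (T x) / norm x)"

definition crudely_fin_rep ::
    "real \<Rightarrow> 'a::real_normed_vector set \<Rightarrow> 'b::real_normed_vector set \<Rightarrow> bool" where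
  "crudely_fin_rep C X W \<longleftrightarrow>
     (\<forall>E. subspace E \<and> E \<subseteq> X \<and> fin_dim E \<longrightarrow>
       (\<exists>T. linear_map_on E T \<and> inj_on T E \<and> T ` E \<subseteq> W \<and>
          onorm_on E T * onorm_on (T ` E) (inv_into E T) < C))"

definition crudely_fin_rep_in_cof ::
    "'a::real_normed_vector set \<Rightarrow> 'b::real_normed_vector set \<Rightarrow> bool" where
  "crudely_fin_rep_in_cof X Y \<longleftrightarrow> (\<exists>C>1. \<forall>Z\<in>cof Y. crudely_fin_rep C X Z)"

definition proper_metric :: "'a metric \<Rightarrow> bool" where
  "proper_metric m \<longleftrightarrow> (\<forall>x\<in>mspace m. \<forall>r. compactin (mtopology_of m) (mcball_of m x r))"

text \<open>Functions \<open>[0,\<infinity>) \<rightarrow> [0,1)\<close> are represented by functions on the reals constrained only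
  on \<open>[0,\<infinity>)\<close>; their values at negative reals are irrelevant.\<close>

definition almost_bilipschitz_embeddable :: "'a metric \<Rightarrow> 'b metric \<Rightarrow> bool" where
  "almost_bilipschitz_embeddable m n \<longleftrightarrow>
     (\<forall>A::real. A > 0 \<longrightarrow>
       (\<exists>r D::real. r > 0 \<and> D \<ge> 1 \<and>
         (\<forall>\<phi>::real \<Rightarrow> real.
            continuous_on {0..} \<phi> \<and> \<phi> ` {0..} \<subseteq> {0..<1} \<and> \<phi> 0 = 0 \<and> (\<forall>t>0. \<phi> t > 0) \<longrightarrow>
            (\<exists>f. f ` mspace m \<subseteq> mspace n \<and>
               (\<forall>x\<in>mspace m. \<forall>y\<in>mspace m.
                  \<phi> (mdist m x y) * r * mdist m x y \<le> mdist n (f x) (f y) \<and>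
                  mdist n (f x) (f y) \<le> D * r * mdist m x y + A)))))"

end

theory Submission
  imports Defs
begin

text \<open>A linear embedding of all of \<open>X\<close> into \<open>Y\<close> need not exist, but every finite-dimensional subspace of
  \<open>X\<close> embeds linearly into \<open>Y\<close> with uniform constants, and this even inside any prescribed closed
  subspace of finite codimension. The proof glues countably many such local embeddings.

  Independence of the copies. By Mazur's method a finite-dimensional subspace \<open>G\<close> of \<open>Y\<close> has an
  almost transversal closed subspace of finite codimension, that is, one with
  \<open>norm g \<le> 2 * norm (g + z)\<close> for \<open>g\<close> in \<open>G\<close> and \<open>z\<close> in this subspace (\<open>cof_almost_transversal\<close>,
  from the Hahn--Banach theorem and compactness of the sphere of \<open>G\<close>). Placing the copies of a
  sequence of finite-dimensional subspaces of \<open>X\<close> one after the other in this way yields blocks such that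
  each term of a convergent block series is bounded by the sum of the series
  (\<open>almost_transversal_copies\<close>).

  Large distances. A vector is the sum of its dyadic pieces, which are Lipschitz cutoffs to shells
  \<open>2 ^ (k - 1) < norm u < 2 ^ (k + 1)\<close>. Since two vectors have at most four nonzero pieces in total, their
  distance is comparable both with the sum of the distances of the pieces and with the largest of them. So
  it does no harm to send every shell into a block of its own.

  Small distances. Balls of \<open>M\<close> are compact but may span an infinite-dimensional space. For
  a scale \<open>\<sigma> j\<close>, rounding to a locally finite \<open>\<sigma> j\<close>-net of \<open>M\<close> leaves only finitely many points in every
  ball, hence a finite-dimensional problem on every shell. Rounding is discontinuous, but its jumps
  are at most \<open>2 * \<sigma> j\<close>, and the additive constant \<open>A\<close> absorbs them. The roundings at all scales
  are added with weights \<open>(1/2) ^ j\<close>, again in different blocks. The upper bound sees only the sum of the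
  weights, while two points at distance \<open>t\<close> are separated at least by \<open>(1/2) ^ j * t\<close> up to a constant
  as soon as \<open>4 * \<sigma> j \<le> t\<close>. As \<open>\<phi>\<close> tends to \<open>0\<close> at \<open>0\<close>, letting \<open>\<sigma> j\<close> decrease fast makes this weight
  dominate \<open>\<phi> t\<close>, while scale \<open>0\<close> with weight \<open>1\<close> takes care of all large \<open>t\<close> because \<open>\<phi> < 1\<close>
  (\<open>scales_for_modulus\<close>). The function \<open>\<phi>\<close> enters only through the choice of the
  scales, so the constants \<open>r = 1/32\<close> and \<open>D = 1536 * C\<close> are the same for all \<open>\<phi>\<close>.\<close>

section \<open>Norming functionals\<close>

definition sublinear :: "('a::real_vector \<Rightarrow> real) \<Rightarrow> bool" where
  "sublinear p \<longleftrightarrow> (\<forall>x y. p (x + y) \<le> p x + p y) \<and> (\<forall>t\<ge>0. \<forall>x. p (t *\<^sub>R x) = t * p x)"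

lemma sublinearI:
  assumes "\<And>x y. p (x + y) \<le> p x + p y" "\<And>t x. t \<ge> 0 \<Longrightarrow> p (t *\<^sub>R x) = t * p x"
  shows "sublinear p"
  using assms by (auto simp: sublinear_def)

lemma sublinear_add: "sublinear p \<Longrightarrow> p (x + y) \<le> p x + p y"
  by (auto simp: sublinear_def)

lemma sublinear_scale: "sublinear p \<Longrightarrow> t \<ge> 0 \<Longrightarrow> p (t *\<^sub>R x) = t * p x"
  by (auto simp: sublinear_def)

lemma sublinear_zero: "sublinear p \<Longrightarrow> p 0 = 0"
  using sublinear_scale[of p 0 0] by simp

lemma sublinear_lower: "sublinear p \<Longrightarrow> - p (- x) \<le> p x"
  using sublinear_add[of p x "- x"] sublinear_zero[of p] by simp

text \<open>Subtracting from \<open>p\<close> as much as possible along the ray of \<open>a\<close> gives a smaller sublinear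
  functional which is forced to be odd at \<open>a\<close>.\<close>

lemma sublinear_shift:
  assumes p: "sublinear p"
  obtains q where "sublinear q" "\<And>x. q x \<le> p x" "q (- a) \<le> - p a"
proof -
  define S where "S x = (\<lambda>t. p (x + t *\<^sub>R a) - t * p a) ` {0..}" for x
  define q where "q x = Inf (S x)" for x
  have lower: "- p (- x) \<le> p (x + t *\<^sub>R a) - t * p a" if "t \<ge> 0" for x t
  proof -
    have "p (t *\<^sub>R a) \<le> p (x + t *\<^sub>R a) + p (- x)"
      using sublinear_add[OF p, of "x + t *\<^sub>R a" "- x"] by simp
    then show ?thesis using sublinear_scale[OF p that] by simp
  qed
  have bdd: "bdd_below (S x)" for x
    using lower by (intro bdd_belowI[of _ "- p (- x)"]) (auto simp: S_def)
  have ne: "S x \<noteq> {}" for x by (auto simp: S_def)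
  have q_le: "q x \<le> p (x + t *\<^sub>R a) - t * p a" if "t \<ge> 0" for x t
    unfolding q_def using bdd that by (intro cInf_lower) (auto simp: S_def)
  have q_ge: "c \<le> q x" if "\<And>t. t \<ge> 0 \<Longrightarrow> c \<le> p (x + t *\<^sub>R a) - t * p a" for c x
    unfolding q_def using ne that by (intro cInf_greatest) (auto simp: S_def)
  have "q (x + y) \<le> q x + q y" for x y
  proof -
    have *: "q (x + y) \<le> (p (x + t *\<^sub>R a) - t * p a) + (p (y + s *\<^sub>R a) - s * p a)"
      if "t \<ge> 0" "s \<ge> 0" for t s
    proof -
      have "q (x + y) \<le> p ((x + y) + (t + s) *\<^sub>R a) - (t + s) * p a"
        using that by (intro q_le) simp
      also have "(x + y) + (t + s) *\<^sub>R a = (x + t *\<^sub>R a) + (y + s *\<^sub>R a)"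
        by (simp add: algebra_simps)
      finally show ?thesis
        using sublinear_add[OF p, of "x + t *\<^sub>R a" "y + s *\<^sub>R a"] by (simp add: algebra_simps)
    qed
    have "q (x + y) - (p (x + t *\<^sub>R a) - t * p a) \<le> q y" if "t \<ge> 0" for t
      using *[OF that] by (intro q_ge) (simp add: algebra_simps)
    then have "q (x + y) - q y \<le> q x"
      by (intro q_ge) (smt (verit))
    then show ?thesis by simp
  qed
  moreover have "q (r *\<^sub>R x) = r * q x" if "r \<ge> 0" for r x
  proof (cases "r = 0")
    case True
    have "q 0 \<le> 0" using q_le[of 0 0] sublinear_zero[OF p] by simp
    moreover have "0 \<le> q 0" using lower[of _ 0] sublinear_zero[OF p] by (intro q_ge) simp
    ultimately show ?thesis using True by simp
  next
    case False
    have half: "r * q x \<le> q (r *\<^sub>R x)" if "r > 0" for r x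
    proof (rule q_ge)
      fix t :: real assume "t \<ge> 0"
      then have "q x \<le> p (x + (t / r) *\<^sub>R a) - (t / r) * p a" using that by (intro q_le) simp
      then have "r * q x \<le> r * p (x + (t / r) *\<^sub>R a) - t * p a"
        using that by (simp add: field_simps)
      also have "r * p (x + (t / r) *\<^sub>R a) = p (r *\<^sub>R (x + (t / r) *\<^sub>R a))"
        using sublinear_scale[OF p, of r] that by simp
      finally show "r * q x \<le> p (r *\<^sub>R x + t *\<^sub>R a) - t * p a"
        using that by (simp add: scaleR_add_right)
    qed
    have r: "r > 0" using that False by simp
    have "inverse r * q (r *\<^sub>R x) \<le> q x" using half[of "inverse r" "r *\<^sub>R x"] r by simp
    then have "q (r *\<^sub>R x) \<le> r * q x" using r by (simp add: field_simps)
    with half[OF r, of x] show ?thesis by simp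
  qed
  ultimately have "sublinear q" by (intro sublinearI)
  moreover have "q x \<le> p x" for x using q_le[of 0 x] by simp
  moreover have "q (- a) \<le> - p a" using q_le[of 1 "- a"] sublinear_zero[OF p] by simp
  ultimately show thesis by (rule that)
qed

text \<open>A minimal element below \<open>p\<close> among the sublinear functionals is linear: by minimality the
  functional of \<open>sublinear_shift\<close> is the minimal one itself, so the latter is odd everywhere, and
  an odd sublinear functional is additive and homogeneous. Zorn's lemma provides the minimal element,
  since the pointwise infimum of a chain stays bounded below by \<open>- p (- x)\<close>.\<close>

lemma sublinear_dominates_linear:
  fixes p :: "'a::real_vector \<Rightarrow> real"
  assumes p: "sublinear p"
  obtains f where "linear f" "\<And>x. f x \<le> p x"
proof -
  define A where "A = {q. sublinear q \<and> q \<le> p}"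
  define P where "P = (\<lambda>q q' :: 'a \<Rightarrow> real. q' \<le> q)"
  have "\<exists>m\<in>A. \<forall>a\<in>A. P m a \<longrightarrow> a = m"
  proof (rule predicate_Zorn)
    show "partial_order_on A (relation_of P A)"
      by (rule partial_order_on_relation_ofI) (auto simp: P_def)
  next
    fix C assume C: "C \<in> Chains (relation_of P A)"
    have CA: "C \<subseteq> A" using C unfolding Chains_def relation_of_def by auto
    have chain: "q \<le> q' \<or> q' \<le> q" if "q \<in> C" "q' \<in> C" for q q'
      using C that unfolding Chains_def relation_of_def P_def by auto
    show "\<exists>u\<in>A. \<forall>a\<in>C. P a u"
    proof (cases "C = {}")
      case True
      then show ?thesis using p by (auto simp: A_def)
    next
      case False
      define u where "u x = (INF q\<in>C. q x)" for x
      have bdd: "bdd_below ((\<lambda>q. q x) ` C)" for x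
      proof (rule bdd_belowI)
        fix y assume "y \<in> (\<lambda>q. q x) ` C"
        then obtain q where "q \<in> C" "y = q x" by auto
        moreover from this CA have "sublinear q" "q (- x) \<le> p (- x)"
          by (auto simp: A_def le_fun_def)
        ultimately show "- p (- x) \<le> y" using sublinear_lower[of q x] by simp
      qed
      have u_le: "u x \<le> q x" if "q \<in> C" for q x
        unfolding u_def by (rule cINF_lower[OF bdd that])
      have u_ge: "c \<le> u x" if "\<And>q. q \<in> C \<Longrightarrow> c \<le> q x" for c x
        unfolding u_def using False that by (intro cINF_greatest)
      have "u (x + y) \<le> u x + u y" for x y
      proof -
        have *: "u (x + y) \<le> q x + q' y" if q: "q \<in> C" "q' \<in> C" for q q'
        proof -
          define m where "m = (if q \<le> q' then q else q')"
          have m: "m \<in> C" "m \<le> q" "m \<le> q'" using q chain[OF q] by (auto simp: m_def)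
          have "u (x + y) \<le> m (x + y)" using m u_le by simp
          also have "\<dots> \<le> m x + m y" using m CA sublinear_add by (auto simp: A_def)
          also have "\<dots> \<le> q x + q' y" using m by (intro add_mono) (auto simp: le_fun_def)
          finally show ?thesis .
        qed
        have "u (x + y) - q x \<le> u y" if "q \<in> C" for q
          using *[OF that] by (intro u_ge) (simp add: algebra_simps)
        then have "u (x + y) - u y \<le> u x" by (intro u_ge) (smt (verit))
        then show ?thesis by simp
      qed
      moreover have "u (r *\<^sub>R x) = r * u x" if "r \<ge> 0" for r x
      proof (cases "r = 0")
        case True
        have "q 0 = 0" if "q \<in> C" for q using that CA sublinear_zero by (auto simp: A_def)
        then have "(\<lambda>q. q 0) ` C = (\<lambda>q. 0) ` C" by (intro image_cong) auto
        then have "(\<lambda>q. q 0) ` C = {0}" using False by auto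
        then show ?thesis using True by (simp add: u_def)
      next
        case r0: False
        have scale: "q (r *\<^sub>R x) = r * q x" if "q \<in> C" "r \<ge> 0" for q r x
          using that CA sublinear_scale by (auto simp: A_def)
        have half: "r * u x \<le> u (r *\<^sub>R x)" if "r > 0" for r x
          using u_le that by (intro u_ge) (simp add: scale mult_left_mono)
        have r: "r > 0" using that r0 by simp
        have "inverse r * u (r *\<^sub>R x) \<le> u x" using half[of "inverse r" "r *\<^sub>R x"] r by simp
        then have "u (r *\<^sub>R x) \<le> r * u x" using r by (simp add: field_simps)
        with half[OF r, of x] show ?thesis by simp
      qed
      ultimately have "sublinear u" by (intro sublinearI)
      moreover have "u \<le> p"
      proof -
        obtain q where "q \<in> C" using False by auto
        then show ?thesis
          using u_le[of q] CA by (auto simp: A_def le_fun_def intro: order_trans)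
      qed
      ultimately show ?thesis using u_le by (auto simp: A_def P_def le_fun_def)
    qed
  qed
  then obtain m where m: "sublinear m" "m \<le> p"
    and min: "\<And>q. sublinear q \<Longrightarrow> q \<le> m \<Longrightarrow> q = m"
    unfolding A_def P_def by (auto intro: order_trans)
  have odd: "m (- x) = - m x" for x
  proof -
    obtain q where "sublinear q" "\<And>z. q z \<le> m z" "q (- x) \<le> - m x"
      using sublinear_shift[OF m(1), of x] by blast
    then have "m (- x) \<le> - m x" using min[of q] by (simp add: le_fun_def)
    then show ?thesis using sublinear_lower[OF m(1), of "- x"] by simp
  qed
  have "linear m"
  proof (rule linearI)
    fix x y
    have "m (- x + - y) \<le> m (- x) + m (- y)" by (rule sublinear_add[OF m(1)])
    moreover have "m (- x + - y) = - m (x + y)" using odd[of "x + y"] by simp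
    ultimately show "m (x + y) = m x + m y"
      using sublinear_add[OF m(1), of x y] odd by simp
  next
    fix r :: real and x
    show "m (r *\<^sub>R x) = r *\<^sub>R m x"
    proof (cases "r \<ge> 0")
      case True
      then show ?thesis using sublinear_scale[OF m(1)] by simp
    next
      case False
      then have "m ((- r) *\<^sub>R x) = - r * m x" by (intro sublinear_scale[OF m(1)]) simp
      then show ?thesis using odd[of "r *\<^sub>R x"] by simp
    qed
  qed
  then show thesis using m(2) that by (auto simp: le_fun_def)
qed

text \<open>The Hahn--Banach theorem in the form used below. Shifting the norm along \<open>a\<close> first makes every
  linear functional underneath it attain the norm at \<open>a\<close>.\<close>

lemma norming_functional:
  fixes a :: "'a::real_normed_vector"
  obtains f :: "'a \<Rightarrow> real" where "linear f" "\<And>x. \<bar>f x\<bar> \<le> norm x" "f a = norm a"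
proof -
  have "sublinear (norm :: 'a \<Rightarrow> real)"
    by (rule sublinearI) (auto simp: norm_triangle_ineq)
  then obtain q :: "'a \<Rightarrow> real" where q: "sublinear q" "\<And>x. q x \<le> norm x" "q (- a) \<le> - norm a"
    using sublinear_shift[of norm a] by blast
  obtain f where f: "linear f" "\<And>x. f x \<le> q x"
    using sublinear_dominates_linear[OF q(1)] by blast
  have le: "f x \<le> norm x" for x using f(2)[of x] q(2)[of x] by simp
  have neg: "f (- x) = - f x" for x using f(1) by (rule linear_neg)
  have "\<bar>f x\<bar> \<le> norm x" for x using le[of x] le[of "- x"] neg by simp
  moreover have "f a = norm a" using f(2)[of "- a"] q(3) neg[of a] le[of a] by simp
  ultimately show thesis using f(1) that by blast
qed

section \<open>Finite-dimensional subspaces and linear maps on them\<close>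

text \<open>As \<open>span B\<close> is closed, a vector \<open>b\<close> outside it has positive distance to it, and this distance
  controls the \<open>b\<close>-coordinate. This is the induction step behind all the usual facts about
  finite-dimensional spaces.\<close>

lemma span_insert_bounded_coordinates:
  fixes b :: "'a::real_normed_vector"
  assumes "closed (span B)"
  obtains K where "K \<ge> 0"
    "\<And>x. x \<in> span (insert b B) \<Longrightarrow>
       \<exists>g\<in>span B. \<exists>c. x = g + c *\<^sub>R b \<and> norm g \<le> K * norm x \<and> \<bar>c\<bar> \<le> K * norm x"
proof (cases "b \<in> span B")
  case True
  show thesis
  proof (rule that[of 1])
    fix x assume "x \<in> span (insert b B)"
    then have "x \<in> span B" using True span_redundant by blast
    then show "\<exists>g\<in>span B. \<exists>c. x = g + c *\<^sub>R b \<and> norm g \<le> 1 * norm x \<and> \<bar>c\<bar> \<le> 1 * norm x"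
      by (intro bexI[of _ x] exI[of _ 0]) auto
  qed simp
next
  case False
  then have "b \<in> - span B" "open (- span B)" using assms by auto
  then obtain d where d: "d > 0" "ball b d \<subseteq> - span B" by (meson openE)
  have far: "\<bar>c\<bar> * d \<le> norm (g + c *\<^sub>R b)" if "g \<in> span B" for g c
  proof (cases "c = 0")
    case False
    have "(- inverse c) *\<^sub>R g \<in> span B" using that by (rule span_scale)
    then have "(- inverse c) *\<^sub>R g \<notin> ball b d" using d(2) by blast
    then have "d \<le> norm (b + inverse c *\<^sub>R g)" by (simp add: dist_norm)
    then have "\<bar>c\<bar> * d \<le> norm (c *\<^sub>R (b + inverse c *\<^sub>R g))"
      by (simp add: mult_left_mono)
    also have "c *\<^sub>R (b + inverse c *\<^sub>R g) = g + c *\<^sub>R b" using False by (simp add: algebra_simps)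
    finally show ?thesis .
  qed simp
  define K where "K = 1 / d + (1 + norm b / d)"
  show thesis
  proof (rule that[of K])
    show "K \<ge> 0" using d by (simp add: K_def)
    fix x assume "x \<in> span (insert b B)"
    then obtain c where c: "x - c *\<^sub>R b \<in> span B" by (auto simp: span_breakdown_eq)
    have 1: "\<bar>c\<bar> \<le> norm x / d" using far[OF c, of c] d by (simp add: field_simps)
    have "norm (x - c *\<^sub>R b) \<le> norm x + \<bar>c\<bar> * norm b"
      using norm_triangle_ineq4[of x "c *\<^sub>R b"] by simp
    also have "\<dots> \<le> norm x + (norm x / d) * norm b"
      using 1 by (intro add_left_mono mult_right_mono) auto
    finally have 2: "norm (x - c *\<^sub>R b) \<le> (1 + norm b / d) * norm x" by (simp add: algebra_simps)
    have "1 / d * norm x \<le> K * norm x" "(1 + norm b / d) * norm x \<le> K * norm x"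
      using d by (intro mult_right_mono; simp add: K_def)+
    with 1 2 show "\<exists>g\<in>span B. \<exists>c. x = g + c *\<^sub>R b \<and> norm g \<le> K * norm x \<and> \<bar>c\<bar> \<le> K * norm x"
      using c by (intro bexI[of _ "x - c *\<^sub>R b"] exI[of _ c]) auto
  qed
qed

lemma closed_if_compact_balls:
  fixes S :: "'a::real_normed_vector set"
  assumes "\<And>R. compact (S \<inter> cball 0 R)"
  shows "closed S"
  unfolding closed_sequential_limits
proof (intro allI impI, elim conjE)
  fix x l assume x: "\<forall>n. x n \<in> S" "x \<longlonglongrightarrow> l"
  then have "Bseq x" by (meson convergentI convergent_imp_Bseq)
  then obtain R where R: "\<And>n. norm (x n) \<le> R" by (auto simp: Bseq_def)
  have "closed (S \<inter> cball 0 R)" using assms by (rule compact_imp_closed)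
  moreover have "\<And>n. x n \<in> S \<inter> cball 0 R" using x(1) R by simp
  ultimately have "l \<in> S \<inter> cball 0 R" using x(2) by (rule closed_sequentially)
  then show "l \<in> S" by simp
qed

text \<open>By bounded coordinates, the ball of \<open>span (insert b B)\<close> lies in the image of a product of a ball of
  \<open>span B\<close> with an interval.\<close>

lemma compact_span_Int_cball:
  fixes B :: "'a::real_normed_vector set"
  assumes "finite B"
  shows "compact (span B \<inter> cball 0 R)"
  using assms
proof (induction B arbitrary: R)
  case empty
  have "span {} \<inter> cball 0 R \<subseteq> {0::'a}" by auto
  then show ?case by (meson finite.emptyI finite_imp_compact finite_insert finite_subset)
next
  case (insert b B)
  have "closed (span B)" by (rule closed_if_compact_balls) (rule insert.IH)
  then obtain K where K: "K \<ge> 0"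
    "\<And>x. x \<in> span (insert b B) \<Longrightarrow>
       \<exists>g\<in>span B. \<exists>c. x = g + c *\<^sub>R b \<and> norm g \<le> K * norm x \<and> \<bar>c\<bar> \<le> K * norm x"
    using span_insert_bounded_coordinates[of B b] by blast
  define I where "I = (\<lambda>(g, c). g + c *\<^sub>R b) ` ((span B \<inter> cball 0 (K * R)) \<times> {- (K * R)..K * R})"
  have "compact I"
    unfolding I_def case_prod_unfold
    by (intro compact_continuous_image continuous_intros compact_Times insert.IH compact_Icc)
  moreover have "span (insert b B) \<inter> cball 0 R = I \<inter> cball 0 R"
  proof (intro equalityI subsetI)
    fix x assume x: "x \<in> span (insert b B) \<inter> cball 0 R"
    then obtain g c where gc: "g \<in> span B" "x = g + c *\<^sub>R b" "norm g \<le> K * norm x" "\<bar>c\<bar> \<le> K * norm x"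
      using K(2) by blast
    have "K * norm x \<le> K * R" using x K(1) by (intro mult_left_mono) auto
    with gc have "(g, c) \<in> (span B \<inter> cball 0 (K * R)) \<times> {- (K * R)..K * R}" by auto
    then show "x \<in> I \<inter> cball 0 R" using gc(2) x unfolding I_def by force
  next
    fix x assume "x \<in> I \<inter> cball 0 R"
    then obtain g c where "g \<in> span B" "x = g + c *\<^sub>R b" "x \<in> cball 0 R"
      unfolding I_def by auto
    then show "x \<in> span (insert b B) \<inter> cball 0 R"
      by (auto simp: span_breakdown_eq intro!: exI[of _ c])
  qed
  ultimately show ?case by (simp add: compact_Int_closed)
qed

lemma closed_span_finite:
  fixes B :: "'a::real_normed_vector set"
  shows "finite B \<Longrightarrow> closed (span B)"
  by (rule closed_if_compact_balls) (rule compact_span_Int_cball)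

lemma compact_finite_net:
  fixes S :: "'a::metric_space set"
  assumes "compact S" "e > 0"
  obtains N where "finite N" "N \<subseteq> S" "S \<subseteq> (\<Union>x\<in>N. ball x e)"
proof -
  have "\<exists>N. finite N \<and> N \<subseteq> S \<and> S \<subseteq> (\<Union>x\<in>N. ball x e)"
    using seq_compact_imp_totally_bounded[OF compact_imp_seq_compact[OF assms(1)]] assms(2)
    by (elim allE impE)
  then show thesis using that by (elim exE conjE)
qed

lemma linear_map_onD:
  assumes "linear_map_on E T"
  shows "x \<in> E \<Longrightarrow> y \<in> E \<Longrightarrow> T (x + y) = T x + T y"
    and "x \<in> E \<Longrightarrow> T (c *\<^sub>R x) = c *\<^sub>R T x"
  using assms by (auto simp: linear_map_on_def)

lemma linear_map_on_zero: "linear_map_on E T \<Longrightarrow> 0 \<in> E \<Longrightarrow> T 0 = 0"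
  using linear_map_onD(2)[of E T 0 0] by simp

lemma linear_map_on_diff:
  assumes "linear_map_on E T" "subspace E" "x \<in> E" "y \<in> E"
  shows "T (x - y) = T x - T y"
proof -
  have "T (x + (-1) *\<^sub>R y) = T x + T ((-1) *\<^sub>R y)"
    using assms by (intro linear_map_onD(1)[OF assms(1)]) (auto intro: subspace_scale subspace_neg)
  also have "T ((-1) *\<^sub>R y) = (-1) *\<^sub>R T y"
    by (rule linear_map_onD(2)[OF assms(1,4)])
  finally show ?thesis by simp
qed

lemma linear_map_on_bounded:
  fixes T :: "'a::real_normed_vector \<Rightarrow> 'b::real_normed_vector"
  assumes "finite B" "linear_map_on (span B) T"
  obtains K where "\<And>x. x \<in> span B \<Longrightarrow> norm (T x) \<le> K * norm x"
proof -
  have "\<exists>K. \<forall>x\<in>span B. norm (T x) \<le> K * norm x"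
    using assms
  proof (induction B)
    case empty
    then show ?case using linear_map_on_zero[of "{0}" T] by auto
  next
    case (insert b B)
    have sub: "span B \<subseteq> span (insert b B)" by (rule span_mono) auto
    then have "linear_map_on (span B) T"
      using insert.prems unfolding linear_map_on_def by (meson subsetD)
    then obtain L where L: "\<And>x. x \<in> span B \<Longrightarrow> norm (T x) \<le> L * norm x"
      using insert.IH by blast
    obtain K where K: "K \<ge> 0"
      "\<And>x. x \<in> span (insert b B) \<Longrightarrow>
         \<exists>g\<in>span B. \<exists>c. x = g + c *\<^sub>R b \<and> norm g \<le> K * norm x \<and> \<bar>c\<bar> \<le> K * norm x"
      using span_insert_bounded_coordinates[OF closed_span_finite[OF insert.hyps(1)], of b] by blast
    have "norm (T x) \<le> (\<bar>L\<bar> * K + K * norm (T b)) * norm x" if x: "x \<in> span (insert b B)" for x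
    proof -
      obtain g c where gc: "g \<in> span B" "x = g + c *\<^sub>R b" "norm g \<le> K * norm x" "\<bar>c\<bar> \<le> K * norm x"
        using K(2)[OF x] by blast
      have b: "b \<in> span (insert b B)" by (rule span_base) simp
      have "T x = T g + c *\<^sub>R T b"
        using linear_map_onD[OF insert.prems] gc(1,2) b sub span_scale by (metis subsetD)
      then have "norm (T x) \<le> norm (T g) + \<bar>c\<bar> * norm (T b)"
        using norm_triangle_ineq[of "T g" "c *\<^sub>R T b"] by simp
      also have "norm (T g) \<le> \<bar>L\<bar> * norm g"
        using L[OF gc(1)] by (meson abs_ge_self mult_right_mono norm_ge_zero order_trans)
      also have "\<bar>L\<bar> * norm g \<le> \<bar>L\<bar> * (K * norm x)" using gc(3) by (intro mult_left_mono) auto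
      also have "\<bar>c\<bar> * norm (T b) \<le> (K * norm x) * norm (T b)" using gc(4) by (intro mult_right_mono) auto
      finally show ?thesis by (simp add: algebra_simps)
    qed
    then show ?case by blast
  qed
  then show thesis using that by blast
qed

lemma linear_map_on_subspace_image:
  assumes T: "linear_map_on E T" and "subspace E"
  shows "subspace (T ` E)"
proof (rule subspaceI)
  show "0 \<in> T ` E"
    using linear_map_on_zero[OF T] subspace_0[OF assms(2)] by force
next
  fix x y assume "x \<in> T ` E" "y \<in> T ` E"
  then obtain u v where "u \<in> E" "x = T u" "v \<in> E" "y = T v" by auto
  then have "x + y = T (u + v)" "u + v \<in> E"
    using linear_map_onD(1)[OF T] subspace_add[OF assms(2)] by auto
  then show "x + y \<in> T ` E" by blast
next
  fix c x assume "x \<in> T ` E"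
  then obtain u where "u \<in> E" "x = T u" by auto
  then have "c *\<^sub>R x = T (c *\<^sub>R u)" "c *\<^sub>R u \<in> E"
    using linear_map_onD(2)[OF T] subspace_scale[OF assms(2)] by auto
  then show "c *\<^sub>R x \<in> T ` E" by blast
qed

lemma linear_map_on_image_span:
  assumes T: "linear_map_on (span B) T"
  shows "T ` span B = span (T ` B)"
proof
  have "T ` B \<subseteq> T ` span B" using span_superset by (rule image_mono)
  then show "span (T ` B) \<subseteq> T ` span B"
    using linear_map_on_subspace_image[OF T subspace_span] by (rule span_minimal)
next
  have "subspace {x \<in> span B. T x \<in> span (T ` B)}"
    using linear_map_on_zero[OF T span_zero]
    by (intro subspaceI) (auto simp: linear_map_onD[OF T] span_zero span_add span_scale)
  moreover have "B \<subseteq> {x \<in> span B. T x \<in> span (T ` B)}" by (auto intro: span_base)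
  ultimately have "span B \<subseteq> {x \<in> span B. T x \<in> span (T ` B)}" by (intro span_minimal)
  then show "T ` span B \<subseteq> span (T ` B)" by auto
qed

lemma linear_map_on_inv_into:
  assumes T: "linear_map_on E T" and E: "subspace E" and inj: "inj_on T E"
  shows "linear_map_on (T ` E) (inv_into E T)"
  unfolding linear_map_on_def
proof (safe)
  fix x y assume xy: "x \<in> E" "y \<in> E"
  then have "T x + T y = T (x + y)" "x + y \<in> E"
    using linear_map_onD(1)[OF T] subspace_add[OF E] by auto
  then show "inv_into E T (T x + T y) = inv_into E T (T x) + inv_into E T (T y)"
    using inj xy by simp
next
  fix c x assume x: "x \<in> E"
  then have "c *\<^sub>R T x = T (c *\<^sub>R x)" "c *\<^sub>R x \<in> E"
    using linear_map_onD(2)[OF T] subspace_scale[OF E] by auto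
  then show "inv_into E T (c *\<^sub>R T x) = c *\<^sub>R inv_into E T (T x)"
    using inj x by simp
qed

text \<open>\<open>onorm_on\<close> is a supremum of reals and so is informative only for bounded maps; the next three
  lemmas carry an arbitrary bound \<open>K\<close> for that purpose.\<close>

lemma onorm_on_bdd_above:
  assumes "\<And>x. x \<in> E \<Longrightarrow> norm (T x) \<le> K * norm x"
  shows "bdd_above ((\<lambda>x. norm (T x) / norm x) ` E)"
proof (rule bdd_aboveI)
  fix q assume "q \<in> (\<lambda>x. norm (T x) / norm x) ` E"
  then obtain x where x: "x \<in> E" "q = norm (T x) / norm x" by auto
  show "q \<le> \<bar>K\<bar>"
  proof (cases "x = 0")
    case False
    then have "q \<le> K" using x assms[OF x(1)] by (simp add: divide_le_eq)
    then show ?thesis by simp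
  qed (simp add: x)
qed

lemma onorm_on_nonneg:
  assumes "\<And>x. x \<in> E \<Longrightarrow> norm (T x) \<le> K * norm x" "0 \<in> E"
  shows "0 \<le> onorm_on E T"
proof -
  have "norm (T 0) / norm (0 :: 'a) \<le> onorm_on E T"
    unfolding onorm_on_def by (rule cSUP_upper[OF assms(2) onorm_on_bdd_above[OF assms(1)]])
  then show ?thesis by simp
qed

lemma norm_le_onorm_on:
  assumes "\<And>x. x \<in> E \<Longrightarrow> norm (T x) \<le> K * norm x" "x \<in> E"
  shows "norm (T x) \<le> onorm_on E T * norm x"
proof (cases "x = 0")
  case True
  then show ?thesis using assms(1)[OF assms(2)] by simp
next
  case False
  have "norm (T x) / norm x \<le> onorm_on E T"
    unfolding onorm_on_def by (rule cSUP_upper[OF assms(2) onorm_on_bdd_above[OF assms(1)]])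
  then show ?thesis using False by (simp add: divide_le_eq)
qed

text \<open>Rescaling by the norm of the inverse turns a bound on the product of the two norms into separate
  bounds. The image stays in \<open>W\<close> because \<open>W\<close> is a subspace.\<close>

lemma crudely_fin_rep_expanding_copy:
  fixes B :: "'a::real_normed_vector set" and W :: "'b::real_normed_vector set"
  assumes rep: "crudely_fin_rep C X W" and W: "subspace W"
    and B: "finite B" "span B \<subseteq> X"
  obtains T where "linear_map_on (span B) T" "T ` span B \<subseteq> W"
    "\<And>x. x \<in> span B \<Longrightarrow> norm x \<le> norm (T x)" "\<And>x. x \<in> span B \<Longrightarrow> norm (T x) \<le> C * norm x"
proof -
  have "fin_dim (span B)"
    unfolding fin_dim_def using B(1) span_superset by blast
  then obtain T where T: "linear_map_on (span B) T" "inj_on T (span B)" "T ` span B \<subseteq> W"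
    and less: "onorm_on (span B) T * onorm_on (T ` span B) (inv_into (span B) T) < C"
    using rep subspace_span B(2) unfolding crudely_fin_rep_def by blast
  define a where "a = onorm_on (span B) T"
  define b where "b = onorm_on (T ` span B) (inv_into (span B) T)"
  obtain K where K: "\<And>x. x \<in> span B \<Longrightarrow> norm (T x) \<le> K * norm x"
    using linear_map_on_bounded[OF B(1) T(1)] by blast
  have img: "T ` span B = span (T ` B)" by (rule linear_map_on_image_span[OF T(1)])
  have "linear_map_on (span (T ` B)) (inv_into (span B) T)"
    using linear_map_on_inv_into[OF T(1) subspace_span T(2)] img by simp
  then obtain L where L: "\<And>y. y \<in> T ` span B \<Longrightarrow> norm (inv_into (span B) T y) \<le> L * norm y"
    using linear_map_on_bounded[of "T ` B"] B(1) img by (metis finite_imageI)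
  have zero: "0 \<in> T ` span B" by (simp add: img span_zero)
  have b0: "0 \<le> b" unfolding b_def by (rule onorm_on_nonneg[OF L zero])
  have a: "norm (T x) \<le> a * norm x" if "x \<in> span B" for x
    unfolding a_def by (rule norm_le_onorm_on[OF K that])
  have b: "norm x \<le> b * norm (T x)" if "x \<in> span B" for x
    unfolding b_def using norm_le_onorm_on[OF L, where x = "T x"] that T(2) by simp
  show thesis
  proof (rule that[of "\<lambda>x. b *\<^sub>R T x"])
    show "linear_map_on (span B) (\<lambda>x. b *\<^sub>R T x)"
      using T(1) by (simp add: linear_map_on_def scaleR_add_right)
    show "(\<lambda>x. b *\<^sub>R T x) ` span B \<subseteq> W"
      using T(3) W by (auto intro: subspace_scale)
    fix x assume x: "x \<in> span B"
    show "norm x \<le> norm (b *\<^sub>R T x)" using b[OF x] b0 by simp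
    have "norm (b *\<^sub>R T x) = b * norm (T x)" using b0 by simp
    also have "\<dots> \<le> b * (a * norm x)" using a[OF x] b0 by (rule mult_left_mono)
    also have "\<dots> = (a * b) * norm x" by simp
    also have "\<dots> \<le> C * norm x" using less by (intro mult_right_mono) (auto simp: a_def b_def)
    finally show "norm (b *\<^sub>R T x) \<le> C * norm x" .
  qed
qed

section \<open>Blocks in almost transversal position\<close>

lemma cof_UNIV: "UNIV \<in> cof UNIV"
  by (auto simp: cof_def)

lemma cof_Int_kernel:
  fixes Z :: "'b::real_normed_vector set" and f :: "'b \<Rightarrow> real"
  assumes Z: "Z \<in> cof UNIV" and f: "linear f" "\<And>x. \<bar>f x\<bar> \<le> norm x"
  shows "{z \<in> Z. f z = 0} \<in> cof UNIV"
proof -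
  obtain B where B: "finite B" "UNIV \<subseteq> span (Z \<union> B)" and sub: "subspace Z" and cl: "closed Z"
    using Z by (auto simp: cof_def)
  let ?K = "{z \<in> Z. f z = 0}"
  have "bounded_linear f"
    using f by (intro bounded_linear_intro[of f 1]) (auto simp: linear_add linear_scale)
  then have "continuous_on UNIV f" by (simp add: linear_continuous_on)
  then have "closed {z. f z = 0}" by (intro closed_Collect_eq) auto
  then have "closed (Z \<inter> {z. f z = 0})" using cl by blast
  then have closed: "closed ?K" by (simp add: Collect_conj_eq)
  have subK: "subspace ?K"
    using sub f(1) by (auto simp: subspace_def linear_add linear_scale linear_0)
  have "\<exists>B'. finite B' \<and> UNIV \<subseteq> span (?K \<union> B')"
  proof (cases "\<exists>z\<in>Z. f z \<noteq> 0")
    case False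
    then have "?K = Z" by auto
    then show ?thesis using B by auto
  next
    case True
    then obtain z where z: "z \<in> Z" "f z \<noteq> 0" by blast
    have "x \<in> span (?K \<union> insert z B)" if "x \<in> Z" for x
    proof -
      have "x - (f x / f z) *\<^sub>R z \<in> ?K"
        using that z sub f(1) by (auto simp: subspace_diff subspace_scale linear_diff linear_scale)
      then have "(x - (f x / f z) *\<^sub>R z) + (f x / f z) *\<^sub>R z \<in> span (?K \<union> insert z B)"
        by (intro span_add span_scale span_base) auto
      then show ?thesis by simp
    qed
    then have "Z \<union> B \<subseteq> span (?K \<union> insert z B)" by (auto intro: span_base)
    then have "span (Z \<union> B) \<subseteq> span (?K \<union> insert z B)" by (intro span_minimal) auto
    then show ?thesis using B by (intro exI[of _ "insert z B"]) auto
  qed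
  then show ?thesis using closed subK by (auto simp: cof_def)
qed

text \<open>Mazur's argument: if finitely many functionals norm a net of the unit sphere of \<open>span B\<close>, then some
  functional is at least \<open>1/2\<close> at any given point of the sphere, and adding a vector \<open>z\<close> in their
  common kernel cannot destroy this.\<close>

lemma cof_almost_transversal:
  fixes Z :: "'b::real_normed_vector set"
  assumes Z: "Z \<in> cof UNIV" and B: "finite B"
  obtains Z' where "Z' \<in> cof UNIV" "Z' \<subseteq> Z"
    "\<And>g z. g \<in> span B \<Longrightarrow> z \<in> Z' \<Longrightarrow> norm g \<le> 2 * norm (g + z)"
proof -
  have "compact ((span B \<inter> cball 0 1) \<inter> sphere 0 1)"
    by (rule compact_Int_closed[OF compact_span_Int_cball[OF B]])
      (unfold sphere_def, intro closed_Collect_eq continuous_intros)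
  then have "compact (span B \<inter> sphere 0 1)"
    by (rule arg_cong[THEN iffD1, rotated]) (auto simp: dist_norm)
  then obtain N where N: "finite N" "N \<subseteq> span B \<inter> sphere 0 1"
    "span B \<inter> sphere 0 1 \<subseteq> (\<Union>x\<in>N. ball x (1/2))"
    by (rule compact_finite_net[of _ "1/2"]) auto
  have "\<forall>a. \<exists>f :: 'b \<Rightarrow> real. linear f \<and> (\<forall>x. \<bar>f x\<bar> \<le> norm x) \<and> f a = norm a"
    using norming_functional by metis
  then obtain f :: "'b \<Rightarrow> 'b \<Rightarrow> real"
    where f: "\<And>a. linear (f a)" "\<And>a x. \<bar>f a x\<bar> \<le> norm x" "\<And>a. f a a = norm a"
    by metis
  have "{z \<in> Z. \<forall>a\<in>N. f a z = 0} \<in> cof UNIV"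
    using N(1)
  proof induction
    case empty
    then show ?case using Z by simp
  next
    case (insert a N)
    have "{z \<in> Z. \<forall>b\<in>insert a N. f b z = 0} = {z \<in> {z \<in> Z. \<forall>b\<in>N. f b z = 0}. f a z = 0}"
      by auto
    then show ?case using cof_Int_kernel[OF insert.IH f(1,2)] by simp
  qed
  moreover have "norm g \<le> 2 * norm (g + z)"
    if g: "g \<in> span B" and z: "z \<in> {z \<in> Z. \<forall>a\<in>N. f a z = 0}" for g z
  proof (cases "g = 0")
    case False
    define u where "u = inverse (norm g) *\<^sub>R g"
    have "u \<in> span B \<inter> sphere 0 1" using False g by (simp add: u_def span_scale)
    then obtain a where a: "a \<in> N" "dist a u < 1/2" using N(3) by (auto simp: ball_def)
    have "norm a = 1" using a(1) N(2) by auto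
    moreover have "\<bar>f a (a - u)\<bar> < 1/2"
      using f(2)[of a "a - u"] a(2) by (simp add: dist_norm)
    ultimately have "1/2 \<le> f a u" using f(3)[of a] linear_diff[OF f(1), of a a u] by linarith
    moreover have "f a u = inverse (norm g) * f a g" by (simp add: u_def linear_scale[OF f(1)])
    ultimately have "norm g \<le> 2 * f a g" using False by (simp add: field_simps)
    also have "f a g = f a (g + z)" using z a(1) linear_add[OF f(1)] by simp
    also have "\<dots> \<le> norm (g + z)" using f(2)[of a "g + z"] by simp
    finally show ?thesis by simp
  qed simp
  ultimately show thesis by (intro that) auto
qed

text \<open>The copies are chosen inductively, the copy number \<open>n + 1\<close> inside a space \<open>Z (n + 1)\<close> that is
  almost transversal to the span \<open>G n\<close> of all earlier copies. The spaces \<open>Z n\<close> decrease and are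
  closed, so the whole tail of a series lies in \<open>Z n\<close>: the partial sums are then bounded by twice the
  sum, with no product of constants to control, and a single term is a difference of two partial sums.\<close>

lemma almost_transversal_copies:
  fixes B :: "nat \<Rightarrow> 'a::real_normed_vector set"
  assumes rep: "\<And>Z. Z \<in> cof (UNIV :: 'b::real_normed_vector set) \<Longrightarrow> crudely_fin_rep C (UNIV :: 'a set) Z"
    and B: "\<And>n. finite (B n)"
  obtains T :: "nat \<Rightarrow> 'a \<Rightarrow> 'b::real_normed_vector"
  where "\<And>n. linear_map_on (span (B n)) (T n)"
    "\<And>n x. x \<in> span (B n) \<Longrightarrow> norm x \<le> norm (T n x)"
    "\<And>n x. x \<in> span (B n) \<Longrightarrow> norm (T n x) \<le> C * norm x"
    "\<And>y m. (\<And>n. y n \<in> T n ` span (B n)) \<Longrightarrow> summable y \<Longrightarrow> norm (y m) \<le> 4 * norm (suminf y)"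
proof -
  \<comment> \<open>The state after step \<open>n\<close>: the copy \<open>T\<close>, the space \<open>Z\<close> that contains it, and a finite
    set \<open>G\<close> whose span contains this copy and all earlier ones.\<close>
  define P where "P n s = (case s of (T, Z, G) \<Rightarrow> linear_map_on (span (B n)) T
      \<and> (\<forall>x\<in>span (B n). norm x \<le> norm (T x) \<and> norm (T x) \<le> C * norm x)
      \<and> Z \<in> cof UNIV \<and> finite G \<and> T ` span (B n) \<subseteq> Z \<and> T ` span (B n) \<subseteq> span G)"
    for n and s :: "('a \<Rightarrow> 'b) \<times> 'b set \<times> 'b set"
  define Q where "Q s s' = (case (s, s') of ((T, Z, G), (T', Z', G')) \<Rightarrow> Z' \<subseteq> Z \<and> G \<subseteq> G'
      \<and> (\<forall>g\<in>span G. \<forall>z\<in>Z'. norm g \<le> 2 * norm (g + z)))"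
    for s s' :: "('a \<Rightarrow> 'b) \<times> 'b set \<times> 'b set"
  have step: "\<exists>T. P n (T, Z, G \<union> T ` B n)" if Z: "Z \<in> cof UNIV" and G: "finite G" for n Z G
  proof -
    have "subspace Z" using Z by (simp add: cof_def)
    then obtain T where T: "linear_map_on (span (B n)) T" "T ` span (B n) \<subseteq> Z"
      "\<And>x. x \<in> span (B n) \<Longrightarrow> norm x \<le> norm (T x)"
      "\<And>x. x \<in> span (B n) \<Longrightarrow> norm (T x) \<le> C * norm x"
      using crudely_fin_rep_expanding_copy[OF rep[OF Z] _ B, of n] by blast
    have "T ` span (B n) \<subseteq> span (G \<union> T ` B n)"
      unfolding linear_map_on_image_span[OF T(1)] by (rule span_mono) auto
    then show ?thesis using T Z G B[of n] by (intro exI[of _ T]) (auto simp: P_def)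
  qed
  have "\<exists>s. \<forall>n. P n (s n) \<and> Q (s n) (s (Suc n))"
  proof (rule dependent_nat_choice)
    show "\<exists>s. P 0 s" using step[OF cof_UNIV, of "{}"] by blast
  next
    fix s n assume s: "P n s"
    obtain T Z G where [simp]: "s = (T, Z, G)" by (cases s)
    from s have "Z \<in> cof UNIV" and G: "finite G" by (auto simp: P_def)
    then obtain Z' where Z': "Z' \<in> cof UNIV" "Z' \<subseteq> Z"
      "\<And>g z. g \<in> span G \<Longrightarrow> z \<in> Z' \<Longrightarrow> norm g \<le> 2 * norm (g + z)"
      using cof_almost_transversal by blast
    obtain T' where "P (Suc n) (T', Z', G \<union> T' ` B (Suc n))" using step[OF Z'(1) G] by blast
    moreover have "Q s (T', Z', G \<union> T' ` B (Suc n))" using Z' by (auto simp: Q_def)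
    ultimately show "\<exists>s'. P (Suc n) s' \<and> Q s s'" by blast
  qed
  then obtain s where s: "\<And>n. P n (s n)" "\<And>n. Q (s n) (s (Suc n))" by blast
  define T where "T n = fst (s n)" for n
  define Z where "Z n = fst (snd (s n))" for n
  define G where "G n = snd (snd (s n))" for n
  have s_eq: "s n = (T n, Z n, G n)" for n by (simp add: T_def Z_def G_def)
  have T: "linear_map_on (span (B n)) (T n)"
      "\<And>x. x \<in> span (B n) \<Longrightarrow> norm x \<le> norm (T n x)"
      "\<And>x. x \<in> span (B n) \<Longrightarrow> norm (T n x) \<le> C * norm x"
      "Z n \<in> cof UNIV" "T n ` span (B n) \<subseteq> Z n" "T n ` span (B n) \<subseteq> span (G n)" for n
    using s(1)[of n] unfolding P_def s_eq by auto
  have Q: "Z (Suc n) \<subseteq> Z n" "G n \<subseteq> G (Suc n)"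
      "\<And>g z. g \<in> span (G n) \<Longrightarrow> z \<in> Z (Suc n) \<Longrightarrow> norm g \<le> 2 * norm (g + z)" for n
    using s(2)[of n] unfolding Q_def s_eq by auto
  have Z_mono: "Z n \<subseteq> Z m" if "m \<le> n" for m n
    using that Q(1) by (rule lift_Suc_antimono_le[rotated])
  have G_mono: "G m \<subseteq> G n" if "m \<le> n" for m n
    using that Q(2) by (rule lift_Suc_mono_le[rotated])
  have partial: "norm (\<Sum>i<n. y i) \<le> 2 * norm (suminf y)"
    if y: "\<And>n. y n \<in> T n ` span (B n)" and sm: "summable y" for y n
  proof (cases n)
    case (Suc m)
    have head: "(\<Sum>i<n. y i) \<in> span (G m)"
    proof (rule span_sum)
      fix i assume "i \<in> {..<n}"
      then have "i \<le> m" using Suc by simp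
      then show "y i \<in> span (G m)" using y[of i] T(6)[of i] span_mono[OF G_mono] by blast
    qed
    have ZZ: "subspace (Z n)" "closed (Z n)" using T(4)[of n] by (auto simp: cof_def)
    have "(\<Sum>i<k. y (i + n)) \<in> Z n" for k
    proof (rule subspace_sum[OF ZZ(1)])
      fix i show "y (i + n) \<in> Z n" using y[of "i + n"] T(5)[of "i + n"] Z_mono[of n "i + n"] by auto
    qed
    moreover have "(\<lambda>k. \<Sum>i<k. y (i + n)) \<longlonglongrightarrow> (\<Sum>i. y (i + n))"
      by (rule summable_LIMSEQ) (rule summable_ignore_initial_segment[OF sm])
    ultimately have "(\<Sum>i. y (i + n)) \<in> Z n"
      by (rule closed_sequentially[OF ZZ(2)])
    then have "norm (\<Sum>i<n. y i) \<le> 2 * norm ((\<Sum>i<n. y i) + (\<Sum>i. y (i + n)))"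
      using Q(3)[OF head] Suc by simp
    then show ?thesis using suminf_split_initial_segment[OF sm, of n] by (simp add: add.commute)
  qed simp
  have "norm (y m) \<le> 4 * norm (suminf y)"
    if y: "\<And>n. y n \<in> T n ` span (B n)" and sm: "summable y" for y m
  proof -
    have "y m = (\<Sum>i<Suc m. y i) - (\<Sum>i<m. y i)" by simp
    then have "norm (y m) \<le> norm (\<Sum>i<Suc m. y i) + norm (\<Sum>i<m. y i)"
      by (metis norm_triangle_ineq4)
    then show ?thesis using partial[OF y sm, of "Suc m"] partial[OF y sm, of m] by simp
  qed
  then show thesis using T by (intro that) auto
qed

section \<open>Dyadic decomposition by truncations\<close>

text \<open>The sum of the pieces is the vector itself, each piece is Lipschitz with a constant that does not
  depend on the scale, each piece lives on bounded vectors, and at most two pieces of a vector are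
  nonzero. Mapping the pieces into independent blocks therefore replaces a linear map on an
  infinite-dimensional space, at the price of a constant, by linear maps on finite-dimensional
  spaces.\<close>

definition cutoff :: "real \<Rightarrow> real \<Rightarrow> real" where
  "cutoff s t = max 0 (min 1 (2 - t / s))"

definition truncation :: "real \<Rightarrow> 'a::real_normed_vector \<Rightarrow> 'a" where
  "truncation s u = cutoff s (norm u) *\<^sub>R u"

fun dyadic_piece :: "nat \<Rightarrow> 'a::real_normed_vector \<Rightarrow> 'a" where
  "dyadic_piece 0 u = truncation 1 u"
| "dyadic_piece (Suc k) u = truncation (2 ^ Suc k) u - truncation (2 ^ k) u"

lemma truncation_eq_0: "s > 0 \<Longrightarrow> 2 * s \<le> norm u \<Longrightarrow> truncation s u = 0"
  by (simp add: truncation_def cutoff_def field_simps)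

lemma truncation_eq_self: "s > 0 \<Longrightarrow> norm u \<le> s \<Longrightarrow> truncation s u = u"
  by (simp add: truncation_def cutoff_def field_simps)

lemma cutoff_lipschitz:
  assumes "s > 0" shows "\<bar>cutoff s a - cutoff s b\<bar> \<le> \<bar>a - b\<bar> / s"
proof -
  have "\<bar>cutoff s a - cutoff s b\<bar> \<le> \<bar>(2 - a / s) - (2 - b / s)\<bar>"
    unfolding cutoff_def by linarith
  also have "(2 - a / s) - (2 - b / s) = (b - a) / s" by (simp add: diff_divide_distrib)
  also have "\<bar>(b - a) / s\<bar> = \<bar>a - b\<bar> / s" using assms by (simp add: abs_minus_commute)
  finally show ?thesis .
qed

text \<open>The cutoff varies at rate \<open>1 / s\<close>, but only on vectors of norm at most \<open>2 * s\<close>, so \<open>s\<close> cancels.\<close>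

lemma truncation_lipschitz:
  fixes u v :: "'a::real_normed_vector"
  assumes s: "s > 0"
  shows "norm (truncation s u - truncation s v) \<le> 3 * norm (u - v)"
proof -
  have main: "norm (truncation s u - truncation s v) \<le> 3 * norm (u - v)"
    if v: "norm v \<le> 2 * s" for u v :: 'a
  proof -
    have 1: "\<bar>cutoff s (norm u)\<bar> \<le> 1" by (simp add: cutoff_def)
    have "\<bar>cutoff s (norm u) - cutoff s (norm v)\<bar> \<le> \<bar>norm u - norm v\<bar> / s"
      by (rule cutoff_lipschitz[OF s])
    also have "\<dots> \<le> norm (u - v) / s"
      using s by (intro divide_right_mono norm_triangle_ineq3) simp
    finally have "\<bar>cutoff s (norm u) - cutoff s (norm v)\<bar> * norm v \<le> norm (u - v) / s * (2 * s)"
      using v s by (intro mult_mono) auto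
    then have 2: "\<bar>cutoff s (norm u) - cutoff s (norm v)\<bar> * norm v \<le> 2 * norm (u - v)"
      using s by simp
    have "truncation s u - truncation s v
        = cutoff s (norm u) *\<^sub>R (u - v) + (cutoff s (norm u) - cutoff s (norm v)) *\<^sub>R v"
      by (simp add: truncation_def algebra_simps)
    then have "norm (truncation s u - truncation s v)
        \<le> \<bar>cutoff s (norm u)\<bar> * norm (u - v) + \<bar>cutoff s (norm u) - cutoff s (norm v)\<bar> * norm v"
      by (metis norm_scaleR norm_triangle_ineq)
    also have "\<dots> \<le> 1 * norm (u - v) + 2 * norm (u - v)"
      using 1 2 by (intro add_mono mult_right_mono) auto
    finally show ?thesis by simp
  qed
  consider "norm v \<le> 2 * s" | "norm u \<le> 2 * s" | "2 * s \<le> norm u" "2 * s \<le> norm v" by linarith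
  then show ?thesis
  proof cases
    case 1 then show ?thesis by (rule main)
  next
    case 2 then show ?thesis using main[of u v] by (simp add: norm_minus_commute)
  next
    case 3 then show ?thesis using s by (simp add: truncation_eq_0)
  qed
qed

lemma dyadic_piece_zero [simp]: "dyadic_piece k 0 = 0"
  by (cases k) (simp_all add: truncation_def)

lemma dyadic_piece_in_span: "dyadic_piece k u \<in> span {u}"
  by (cases k) (auto simp: truncation_def simp del: power_Suc intro!: span_diff intro: span_scale span_base)

lemma sum_dyadic_pieces: "(\<Sum>k\<le>n. dyadic_piece k u) = truncation (2 ^ n) u"
  by (induction n) simp_all

lemma dyadic_piece_lipschitz: "norm (dyadic_piece k u - dyadic_piece k v) \<le> 6 * norm (u - v)"
proof (cases k)
  case 0
  then show ?thesis using truncation_lipschitz[of 1 u v] by (simp add: order_trans[OF _ mult_right_mono])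
next
  case (Suc n)
  have "dyadic_piece k u - dyadic_piece k v
      = (truncation (2 ^ k) u - truncation (2 ^ k) v) - (truncation (2 ^ n) u - truncation (2 ^ n) v)"
    by (simp add: Suc)
  then have "norm (dyadic_piece k u - dyadic_piece k v)
      \<le> norm (truncation (2 ^ k) u - truncation (2 ^ k) v) + norm (truncation (2 ^ n) u - truncation (2 ^ n) v)"
    by (metis norm_triangle_ineq4)
  then show ?thesis using truncation_lipschitz[of "2 ^ k" u v] truncation_lipschitz[of "2 ^ n" u v] by simp
qed

lemma dyadic_piece_supportD:
  assumes "dyadic_piece k u \<noteq> 0"
  shows "norm u < 2 ^ Suc k" "k = Suc n \<Longrightarrow> 2 ^ n < norm u"
proof -
  show "norm u < 2 ^ Suc k"
  proof (rule ccontr)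
    assume "\<not> ?thesis"
    then have "2 * 2 ^ k \<le> norm u" by simp
    moreover have "2 * 2 ^ n \<le> norm u" if "k = Suc n" for n
    proof -
      have "(0::real) \<le> 2 ^ k" by simp
      then have "2 ^ k \<le> norm u" using \<open>2 * 2 ^ k \<le> norm u\<close> by linarith
      then show ?thesis using that by simp
    qed
    ultimately show False using assms
      by (cases k) (auto simp: truncation_eq_0)
  qed
  show "2 ^ n < norm u" if k: "k = Suc n"
  proof (rule ccontr)
    assume "\<not> ?thesis"
    then have le: "norm u \<le> 2 ^ n" by simp
    moreover have "(2::real) ^ n \<le> 2 ^ k" using k by simp
    ultimately have "norm u \<le> 2 ^ k" by linarith
    then have "truncation (2 ^ k) u = u" "truncation (2 ^ n) u = u"
      using le by (auto intro: truncation_eq_self)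
    then show False using assms k by simp
  qed
qed

text \<open>The support of piece \<open>k\<close> is the shell \<open>2 ^ (k - 1) < norm u < 2 ^ (k + 1)\<close> (a ball for \<open>k = 0\<close>),
  and a shell meets only its two neighbours.\<close>

lemma dyadic_support:
  obtains m where "\<forall>k. dyadic_piece k u \<noteq> 0 \<longrightarrow> k = m \<or> k = Suc m"
proof (cases "\<exists>k. dyadic_piece k u \<noteq> 0")
  case True
  define m where "m = (LEAST k. dyadic_piece k u \<noteq> 0)"
  have m: "dyadic_piece m u \<noteq> 0" unfolding m_def using True by (rule LeastI_ex)
  show thesis
  proof (rule that[of m], intro allI impI)
    fix k assume k: "dyadic_piece k u \<noteq> 0"
    have "m \<le> k" unfolding m_def using k by (rule Least_le)
    moreover have "k < m + 2"
    proof (rule ccontr)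
      assume "\<not> ?thesis"
      then obtain n where n: "k = Suc n" "Suc m \<le> n" by (cases k) auto
      have "2 ^ n < norm u" using dyadic_piece_supportD(2)[OF k n(1)] .
      also have "\<dots> < 2 ^ Suc m" using dyadic_piece_supportD(1)[OF m] .
      also have "(2::real) ^ Suc m \<le> 2 ^ n" using n(2) by (rule power_increasing) simp
      finally show False by simp
    qed
    ultimately show "k = m \<or> k = Suc m" by linarith
  qed
qed (use that in blast)

lemma dyadic_difference_support:
  obtains S where "finite S" "card S \<le> 4" "\<forall>k. k \<notin> S \<longrightarrow> dyadic_piece k u - dyadic_piece k v = 0"
proof -
  obtain m where m: "\<forall>k. dyadic_piece k u \<noteq> 0 \<longrightarrow> k = m \<or> k = Suc m"
    by (rule dyadic_support)
  obtain l where l: "\<forall>k. dyadic_piece k v \<noteq> 0 \<longrightarrow> k = l \<or> k = Suc l"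
    by (rule dyadic_support)
  have "card (set [m, Suc m, l, Suc l]) \<le> 4"
    by (rule order_trans[OF card_length]) simp
  then show thesis
    using m l by (intro that[of "set [m, Suc m, l, Suc l]"]) force+
qed

lemma sum_dyadic_differences_le:
  "(\<Sum>k<n. norm (dyadic_piece k u - dyadic_piece k v)) \<le> 24 * norm (u - v)"
proof -
  obtain S where S: "finite S" "card S \<le> 4" "\<forall>k. k \<notin> S \<longrightarrow> dyadic_piece k u - dyadic_piece k v = 0"
    by (rule dyadic_difference_support[of u v])
  have "(\<Sum>k<n. norm (dyadic_piece k u - dyadic_piece k v))
      = (\<Sum>k\<in>{..<n} \<inter> S. norm (dyadic_piece k u - dyadic_piece k v))"
    using S(3) by (intro sum.mono_neutral_right) auto
  also have "\<dots> \<le> (\<Sum>k\<in>S. norm (dyadic_piece k u - dyadic_piece k v))"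
    using S(1) by (intro sum_mono2) auto
  also have "\<dots> \<le> real (card S) * (6 * norm (u - v))"
    by (intro sum_bounded_above dyadic_piece_lipschitz)
  also have "\<dots> \<le> 4 * (6 * norm (u - v))"
    using S(2) by (intro mult_right_mono) auto
  finally show ?thesis by simp
qed

text \<open>The differences of the pieces sum up to \<open>u - v\<close> and at most four of them are nonzero, so one of
  them carries a quarter of the norm.\<close>

lemma dyadic_piece_separates:
  obtains k where "norm (u - v) \<le> 4 * norm (dyadic_piece k u - dyadic_piece k v)"
proof (rule ccontr)
  assume "\<not> thesis"
  then have less: "norm (dyadic_piece k u - dyadic_piece k v) < norm (u - v) / 4" for k
    using that[of k] by (auto simp: not_le[symmetric])
  obtain S where S: "finite S" "card S \<le> 4" "\<forall>k. k \<notin> S \<longrightarrow> dyadic_piece k u - dyadic_piece k v = 0"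
    by (rule dyadic_difference_support[of u v])
  obtain n where n: "max (norm u) (norm v) < 2 ^ n"
    using real_arch_pow[of 2] by (metis one_less_numeral_iff semiring_norm(76))
  have "u - v = (\<Sum>k\<le>n. dyadic_piece k u - dyadic_piece k v)"
    using n by (simp add: sum_subtractf sum_dyadic_pieces truncation_eq_self)
  also have "norm \<dots> \<le> (\<Sum>k\<le>n. norm (dyadic_piece k u - dyadic_piece k v))" by (rule norm_sum)
  also have "\<dots> = (\<Sum>k\<in>{..n} \<inter> S. norm (dyadic_piece k u - dyadic_piece k v))"
    using S(3) by (intro sum.mono_neutral_right) auto
  also have "\<dots> \<le> (\<Sum>k\<in>S. norm (dyadic_piece k u - dyadic_piece k v))"
    using S(1) by (intro sum_mono2) auto
  finally have le: "norm (u - v) \<le> (\<Sum>k\<in>S. norm (dyadic_piece k u - dyadic_piece k v))" .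
  have pos: "0 < norm (u - v)" using less[of 0] norm_ge_zero[of "dyadic_piece 0 u - dyadic_piece 0 v"] by linarith
  then have "S \<noteq> {}" using le by auto
  then have "(\<Sum>k\<in>S. norm (dyadic_piece k u - dyadic_piece k v)) < real (card S) * (norm (u - v) / 4)"
    using S(1) less by (intro sum_bounded_above_strict) (auto simp: card_gt_0_iff)
  also have "\<dots> \<le> 4 * (norm (u - v) / 4)" using S(2) by (intro mult_right_mono) auto
  finally show False using le by simp
qed

section \<open>Nets and scales\<close>

text \<open>Balls in \<open>M\<close> are centred at points of \<open>M\<close>; for the dyadic decomposition balls around the origin
  are needed.\<close>

lemma proper_metric_compact_Int_cball:
  fixes M :: "'a::real_normed_vector set"
  assumes "proper_metric (submetric euclidean_metric M)"
  shows "compact (M \<inter> cball 0 R)"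
proof (cases "M = {}")
  case False
  then obtain x where x: "x \<in> M" by blast
  have "mcball_of (submetric euclidean_metric M) x (norm x + R) = M \<inter> cball x (norm x + R)"
    using x by (auto simp: set_eq_iff)
  moreover have "compactin (mtopology_of (submetric euclidean_metric M))
      (mcball_of (submetric euclidean_metric M) x (norm x + R))"
    using assms x by (auto simp: proper_metric_def)
  ultimately have "compact (M \<inter> cball x (norm x + R))"
    by (simp add: mtopology_of_submetric compactin_subtopology)
  then have "compact ((M \<inter> cball x (norm x + R)) \<inter> cball 0 R)" by (simp add: compact_Int_closed)
  moreover have "cball 0 R \<subseteq> cball x (norm x + R)"
  proof
    fix y :: 'a assume "y \<in> cball 0 R"
    then show "y \<in> cball x (norm x + R)"
      using norm_triangle_ineq4[of x y] by (simp add: dist_norm)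
  qed
  then have "(M \<inter> cball x (norm x + R)) \<inter> cball 0 R = M \<inter> cball 0 R" by blast
  ultimately show ?thesis by simp
qed simp

text \<open>The map \<open>\<pi>\<close> is in general discontinuous. The net is assembled from finite nets of the shells
  \<open>n \<le> norm x \<le> n + 1\<close>; each of these stays inside its own shell, which makes the union locally
  finite.\<close>

lemma locally_finite_net_projection:
  fixes M :: "'a::real_normed_vector set"
  assumes M: "\<And>R. compact (M \<inter> cball 0 R)" and s: "s > 0"
  obtains \<pi> where "\<And>x. x \<in> M \<Longrightarrow> norm (\<pi> x - x) \<le> s" "\<And>R. finite (\<pi> ` M \<inter> cball 0 R)"
proof -
  define A where "A n = (M \<inter> cball 0 (real n + 1)) - ball 0 (real n)" for n :: nat
  have "compact (A n)" for n unfolding A_def by (intro compact_diff M) simp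
  then have "\<exists>N. finite N \<and> N \<subseteq> A n \<and> A n \<subseteq> (\<Union>x\<in>N. ball x s)" for n
    using compact_finite_net[OF _ s] by metis
  then obtain N where N: "\<And>n. finite (N n)" "\<And>n. N n \<subseteq> A n" "\<And>n. A n \<subseteq> (\<Union>x\<in>N n. ball x s)"
    by metis
  have "\<exists>u. u \<in> N (nat \<lfloor>norm x\<rfloor>) \<and> dist u x < s" if "x \<in> M" for x
  proof -
    have "x \<in> A (nat \<lfloor>norm x\<rfloor>)" using that by (simp add: A_def) linarith
    then show ?thesis using N(3) by fastforce
  qed
  then obtain \<pi> where pi: "\<And>x. x \<in> M \<Longrightarrow> \<pi> x \<in> N (nat \<lfloor>norm x\<rfloor>)" "\<And>x. x \<in> M \<Longrightarrow> dist (\<pi> x) x < s"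
    by metis
  show thesis
  proof (rule that[of \<pi>])
    show "norm (\<pi> x - x) \<le> s" if "x \<in> M" for x using pi(2)[OF that] by (simp add: dist_norm)
    fix R :: real
    have "\<pi> ` M \<inter> cball 0 R \<subseteq> (\<Union>n\<in>{..nat \<lfloor>R\<rfloor>}. N n)"
    proof
      fix y assume y: "y \<in> \<pi> ` M \<inter> cball 0 R"
      then obtain n where n: "y \<in> N n" using pi(1) by blast
      then have "real n \<le> norm y" using N(2)[of n] by (auto simp: A_def)
      also have "\<dots> \<le> R" using y by simp
      finally have "n \<le> nat \<lfloor>R\<rfloor>" by linarith
      then show "y \<in> (\<Union>n\<in>{..nat \<lfloor>R\<rfloor>}. N n)" using n by blast
    qed
    then show "finite (\<pi> ` M \<inter> cball 0 R)"
      by (rule finite_subset) (use N(1) in auto)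
  qed
qed

text \<open>Scale \<open>j\<close> will separate points at distance at least \<open>4 * \<sigma> j\<close> and carries the weight \<open>(1/2) ^ j\<close>.
  Continuity at \<open>0\<close> allows to choose \<open>\<sigma> j\<close> so small that \<open>\<phi>\<close> is already below the next weight
  on the distances that scale \<open>j\<close> misses. The first scale that sees a distance \<open>t\<close> then has a
  weight of at least \<open>\<phi> t\<close>.\<close>

lemma scales_for_modulus:
  fixes \<phi> :: "real \<Rightarrow> real"
  assumes cont: "continuous_on {0..} \<phi>" and zero: "\<phi> 0 = 0" and le1: "\<And>t. t \<ge> 0 \<Longrightarrow> \<phi> t \<le> 1"
    and s: "s > 0"
  obtains \<sigma> :: "nat \<Rightarrow> real" where "\<forall>j. 0 < \<sigma> j \<and> \<sigma> j \<le> s"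
    "\<forall>t>0. \<exists>j. 4 * \<sigma> j \<le> t \<and> \<phi> t \<le> (1/2) ^ j"
proof -
  have "\<exists>\<sigma>>0. \<sigma> \<le> s \<and> \<sigma> \<le> (1/2) ^ j \<and> (\<forall>t. 0 \<le> t \<and> t < 4 * \<sigma> \<longrightarrow> \<phi> t \<le> (1/2) ^ Suc j)" for j :: nat
  proof -
    have "(0::real) < (1/2) ^ Suc j" by simp
    then obtain d where d: "d > 0" "\<And>t. t \<in> {0..} \<Longrightarrow> dist t 0 < d \<Longrightarrow> dist (\<phi> t) (\<phi> 0) < (1/2) ^ Suc j"
      using cont unfolding continuous_on_iff by (metis atLeast_iff order_refl)
    have small: "\<phi> t \<le> (1/2) ^ Suc j" if "0 \<le> t" "t < d" for t
      using d(2)[of t] that zero by (auto simp: dist_real_def)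
    \<comment> \<open>The bound by \<open>(1/2) ^ j\<close> makes the scales tend to \<open>0\<close>, so that every distance is seen.\<close>
    define \<sigma> where "\<sigma> = min (min s ((1/2) ^ j)) (d / 4)"
    have "\<sigma> > 0" "\<sigma> \<le> s" "\<sigma> \<le> (1/2) ^ j" "4 * \<sigma> \<le> d"
      using s d(1) by (auto simp: \<sigma>_def)
    then show ?thesis using small by (intro exI[of _ \<sigma>]) auto
  qed
  then obtain \<sigma> :: "nat \<Rightarrow> real" where \<sigma>: "\<And>j. 0 < \<sigma> j" "\<And>j. \<sigma> j \<le> s" "\<And>j. \<sigma> j \<le> (1/2) ^ j"
    "\<And>j t. 0 \<le> t \<Longrightarrow> t < 4 * \<sigma> j \<Longrightarrow> \<phi> t \<le> (1/2) ^ Suc j"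
    by metis
  have "\<exists>j. 4 * \<sigma> j \<le> t \<and> \<phi> t \<le> (1/2) ^ j" if t: "t > 0" for t
  proof -
    obtain n where "(1/2) ^ n < t / 4" using real_arch_pow_inv[of "t / 4" "1/2"] t by auto
    then have ex: "4 * \<sigma> n \<le> t" using \<sigma>(3)[of n] by simp
    define j where "j = (LEAST j. 4 * \<sigma> j \<le> t)"
    have "4 * \<sigma> j \<le> t" unfolding j_def using ex by (rule LeastI)
    moreover have "\<phi> t \<le> (1/2) ^ j"
    proof (cases j)
      case 0
      then show ?thesis using le1[of t] t by simp
    next
      case (Suc i)
      then have "\<not> 4 * \<sigma> i \<le> t" using not_less_Least[of i "\<lambda>j. 4 * \<sigma> j \<le> t"] by (simp add: j_def)
      then show ?thesis using \<sigma>(4)[of t i] t Suc by simp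
    qed
    ultimately show ?thesis by blast
  qed
  then show thesis using \<sigma>(1,2) that by blast
qed

section \<open>The multiscale embedding\<close>

text \<open>Index \<open>n\<close> enumerates the pairs \<open>(k, j)\<close> of a dyadic piece \<open>k\<close> and a scale \<open>j\<close>. Here \<open>u j\<close> and
  \<open>v j\<close> are the approximations at scale \<open>j\<close> of two points; the weights sum to \<open>2\<close> and the pieces at
  each scale contribute at most \<open>24 * a\<close>. The choice \<open>v = 0\<close> gives the convergence of the series
  that defines the embedding.\<close>

lemma weighted_dyadic_sum_le:
  fixes u v :: "nat \<Rightarrow> 'a::real_normed_vector"
  assumes a: "\<And>j. norm (u j - v j) \<le> a"
  defines "g \<equiv> \<lambda>(k, j). (1/2) ^ j * norm (dyadic_piece k (u j) - dyadic_piece k (v j))"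
  shows "(\<Sum>n<N. g (prod_decode n)) \<le> 48 * a"
proof -
  have a0: "0 \<le> a" using a[of 0] norm_ge_zero order_trans by blast
  have geom: "(\<Sum>j<N. (1/2 :: real) ^ j) \<le> 2" for N :: nat
  proof -
    have "(\<Sum>j<N. (1/2 :: real) ^ j) = 2 - 2 * (1/2) ^ N" by (induction N) auto
    then show ?thesis by simp
  qed
  have "(\<Sum>n<N. g (prod_decode n)) = (\<Sum>p\<in>prod_decode ` {..<N}. g p)"
    by (simp add: sum.reindex inj_prod_decode)
  also have "\<dots> \<le> (\<Sum>p\<in>{..<N} \<times> {..<N}. g p)"
  proof (rule sum_mono2)
    show "prod_decode ` {..<N} \<subseteq> {..<N} \<times> {..<N}"
    proof
      fix p assume "p \<in> prod_decode ` {..<N}"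
      then have "prod_encode p < N" by auto
      then show "p \<in> {..<N} \<times> {..<N}"
        using le_prod_encode_1[of "fst p" "snd p"] le_prod_encode_2[of "snd p" "fst p"]
        by (cases p) auto
    qed
  qed (auto simp: g_def)
  also have "\<dots> = (\<Sum>k<N. \<Sum>j<N. g (k, j))" by (simp add: sum.cartesian_product)
  also have "\<dots> = (\<Sum>j<N. \<Sum>k<N. g (k, j))" by (rule sum.swap)
  also have "\<dots> = (\<Sum>j<N. (1/2) ^ j * (\<Sum>k<N. norm (dyadic_piece k (u j) - dyadic_piece k (v j))))"
    by (simp add: g_def sum_distrib_left)
  also have "\<dots> \<le> (\<Sum>j<N. (1/2) ^ j * (24 * a))"
  proof (intro sum_mono mult_left_mono)
    fix j
    show "(\<Sum>k<N. norm (dyadic_piece k (u j) - dyadic_piece k (v j))) \<le> 24 * a"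
      using sum_dyadic_differences_le[where n = N and u = "u j" and v = "v j"] a[of j] by linarith
  qed simp
  also have "\<dots> = (\<Sum>j<N. (1/2) ^ j) * (24 * a)" by (simp add: sum_distrib_right)
  also have "\<dots> \<le> 2 * (24 * a)" using geom a0 by (intro mult_right_mono) auto
  finally show ?thesis by simp
qed

text \<open>The embedding is \<open>F x = (\<Sum>(k, j). (1/2) ^ j *\<^sub>R T (dyadic_piece k (\<pi> j x)))\<close> with a separate
  copy map \<open>T\<close> for every pair \<open>(k, j)\<close>, defined on the finite-dimensional span of the net points of
  scale \<open>j\<close> in the ball of radius \<open>2 ^ (k + 1)\<close>. For the lower bound a single well-chosen term of
  \<open>F x - F y\<close> is enough, since the terms are bounded by the sum. In the upper bound the jumps of
  the maps \<open>\<pi> j\<close> produce the additive error.\<close>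

lemma multiscale_embedding:
  fixes M :: "'a::real_normed_vector set"
  assumes C: "C > 0"
    and rep: "\<And>Z. Z \<in> cof (UNIV :: 'b::banach set) \<Longrightarrow> crudely_fin_rep C (UNIV :: 'a set) Z"
    and M: "\<And>R. compact (M \<inter> cball 0 R)"
    and scales: "\<forall>j. 0 < \<sigma> j \<and> \<sigma> j \<le> s"
  obtains F :: "'a \<Rightarrow> 'b::banach"
  where "\<forall>x\<in>M. \<forall>y\<in>M. norm (F x - F y) \<le> 48 * C * (norm (x - y) + 2 * s)"
    "\<forall>x\<in>M. \<forall>y\<in>M. \<forall>j. (1/2) ^ j * (norm (x - y) - 2 * \<sigma> j) \<le> 16 * norm (F x - F y)"
proof -
  have \<sigma>: "0 < \<sigma> j" "\<sigma> j \<le> s" for j using scales by auto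
  have "\<exists>\<pi>. (\<forall>x\<in>M. norm (\<pi> x - x) \<le> \<sigma> j) \<and> (\<forall>R. finite (\<pi> ` M \<inter> cball 0 R))" for j
    by (rule locally_finite_net_projection[OF M \<sigma>(1)[of j]]) blast
  then obtain \<pi> where pi: "\<And>j x. x \<in> M \<Longrightarrow> norm (\<pi> j x - x) \<le> \<sigma> j"
    "\<And>j R. finite (\<pi> j ` M \<inter> cball 0 R)"
    by metis
  define B where "B n = (case prod_decode n of (k, j) \<Rightarrow> \<pi> j ` M \<inter> cball 0 (2 ^ Suc k))" for n
  have "finite (B n)" for n by (simp add: B_def pi(2) split: prod.split)
  then obtain T :: "nat \<Rightarrow> 'a \<Rightarrow> 'b" where T: "\<And>n. linear_map_on (span (B n)) (T n)"
    "\<And>n x. x \<in> span (B n) \<Longrightarrow> norm x \<le> norm (T n x)"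
    "\<And>n x. x \<in> span (B n) \<Longrightarrow> norm (T n x) \<le> C * norm x"
    "\<And>y m. (\<And>n. y n \<in> T n ` span (B n)) \<Longrightarrow> summable y \<Longrightarrow> norm (y m) \<le> 4 * norm (suminf y)"
    using almost_transversal_copies[OF rep] by metis
  define piece where "piece n x = (case prod_decode n of (k, j) \<Rightarrow> (1/2) ^ j *\<^sub>R dyadic_piece k (\<pi> j x))"
    for n x
  have piece_span: "piece n x \<in> span (B n)" if "x \<in> M" for n x
  proof -
    obtain k j where kj: "prod_decode n = (k, j)" by force
    have "dyadic_piece k (\<pi> j x) \<in> span (B n)"
    proof (cases "dyadic_piece k (\<pi> j x) = 0")
      case False
      then have "norm (\<pi> j x) < 2 ^ Suc k" by (rule dyadic_piece_supportD)
      then have "{\<pi> j x} \<subseteq> B n" using that by (simp add: B_def kj)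
      then show ?thesis using dyadic_piece_in_span span_mono by blast
    qed (simp add: span_zero)
    then show ?thesis by (simp add: piece_def kj span_scale)
  qed
  define F where "F x = (\<Sum>n. T n (piece n x))" for x
  have pi_dist: "norm (\<pi> j x - \<pi> j y) \<le> norm (x - y) + 2 * \<sigma> j"
    "norm (x - y) \<le> norm (\<pi> j x - \<pi> j y) + 2 * \<sigma> j" if "x \<in> M" "y \<in> M" for j x y
    using pi(1)[OF that(1), of j] pi(1)[OF that(2), of j]
      norm_triangle_ineq[of "\<pi> j x - x" "y - \<pi> j y"] norm_triangle_ineq[of "x - y" "(\<pi> j x - x) + (y - \<pi> j y)"]
      norm_triangle_ineq4[of "\<pi> j x - \<pi> j y" "(\<pi> j x - x) + (y - \<pi> j y)"]
      norm_minus_commute[of y "\<pi> j y"]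
    by (simp_all add: algebra_simps)
  have norm_piece: "norm (piece n x - piece n y) = (case prod_decode n of (k, j) \<Rightarrow>
      (1/2) ^ j * norm (dyadic_piece k (\<pi> j x) - dyadic_piece k (\<pi> j y)))" for n x y
    by (simp add: piece_def scaleR_diff_right[symmetric] split: prod.split)
  have summable_T: "summable (\<lambda>n. T n (piece n x))" if x: "x \<in> M" for x
  proof -
    have "(\<Sum>n<N. norm (piece n x)) \<le> 48 * (norm x + s)" for N
    proof -
      have "norm (\<pi> j x - 0) \<le> norm x + s" for j
        using pi(1)[OF x, of j] \<sigma>(2)[of j] norm_triangle_ineq2[of "\<pi> j x" x] by simp
      from weighted_dyadic_sum_le[of "\<lambda>j. \<pi> j x" "\<lambda>_. 0", OF this]
      show ?thesis by (simp add: piece_def case_prod_unfold)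
    qed
    then have "summable (\<lambda>n. norm (piece n x))"
      by (intro summableI_nonneg_bounded[of _ "48 * (norm x + s)"]) auto
    then have "summable (\<lambda>n. C * norm (piece n x))" by (rule summable_mult)
    then show ?thesis by (rule summable_comparison_test') (use T(3) piece_span[OF x] in simp)
  qed
  have diff: "T n (piece n x) - T n (piece n y) = T n (piece n x - piece n y)"
    "piece n x - piece n y \<in> span (B n)" if "x \<in> M" "y \<in> M" for n x y
    using linear_map_on_diff[OF T(1) subspace_span] piece_span that by (auto intro: span_diff)
  have F_diff: "F x - F y = (\<Sum>n. T n (piece n x - piece n y))"
    "summable (\<lambda>n. T n (piece n x - piece n y))" if xy: "x \<in> M" "y \<in> M" for x y
    using suminf_diff[OF summable_T[OF xy(1)] summable_T[OF xy(2)]]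
      summable_diff[OF summable_T[OF xy(1)] summable_T[OF xy(2)]]
    by (simp_all add: F_def diff(1)[OF xy])
  show thesis
  proof (rule that[of F]; intro ballI allI)
    fix x y assume xy: "x \<in> M" "y \<in> M"
    let ?d = "\<lambda>n. T n (piece n x - piece n y)"
    have partial: "(\<Sum>n<N. norm (?d n)) \<le> 48 * C * (norm (x - y) + 2 * s)" for N
    proof -
      have "norm (\<pi> j x - \<pi> j y) \<le> norm (x - y) + 2 * s" for j
        using pi_dist(1)[OF xy, of j] \<sigma>(2)[of j] by linarith
      from weighted_dyadic_sum_le[of "\<lambda>j. \<pi> j x" "\<lambda>j. \<pi> j y", OF this]
      have "(\<Sum>n<N. norm (piece n x - piece n y)) \<le> 48 * (norm (x - y) + 2 * s)"
        by (simp add: norm_piece)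
      then have "C * (\<Sum>n<N. norm (piece n x - piece n y)) \<le> C * (48 * (norm (x - y) + 2 * s))"
        using C by (intro mult_left_mono) auto
      moreover have "(\<Sum>n<N. norm (?d n)) \<le> C * (\<Sum>n<N. norm (piece n x - piece n y))"
        unfolding sum_distrib_left by (intro sum_mono T(3) diff(2) xy)
      ultimately show ?thesis by (simp add: algebra_simps)
    qed
    then have "summable (\<lambda>n. norm (?d n))" by (intro summableI_nonneg_bounded) auto
    then have "norm (F x - F y) \<le> (\<Sum>n. norm (?d n))"
      unfolding F_diff(1)[OF xy] by (rule summable_norm)
    also have "\<dots> \<le> 48 * C * (norm (x - y) + 2 * s)"
      using \<open>summable (\<lambda>n. norm (?d n))\<close> partial by (rule suminf_le_const)
    finally show "norm (F x - F y) \<le> 48 * C * (norm (x - y) + 2 * s)" .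
  next
    fix x y j assume xy: "x \<in> M" "y \<in> M"
    obtain k where k: "norm (\<pi> j x - \<pi> j y) \<le> 4 * norm (dyadic_piece k (\<pi> j x) - dyadic_piece k (\<pi> j y))"
      by (rule dyadic_piece_separates)
    define m where "m = prod_encode (k, j)"
    have "(1/2) ^ j * (norm (x - y) - 2 * \<sigma> j) \<le> (1/2) ^ j * (4 * norm (dyadic_piece k (\<pi> j x) - dyadic_piece k (\<pi> j y)))"
      using pi_dist(2)[OF xy, of j] k by (intro mult_left_mono) auto
    also have "\<dots> = 4 * norm (piece m x - piece m y)" by (simp add: norm_piece m_def)
    also have "\<dots> \<le> 4 * norm (T m (piece m x - piece m y))" using T(2)[OF diff(2)[OF xy]] by simp
    also have "norm (T m (piece m x - piece m y)) \<le> 4 * norm (F x - F y)"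
      unfolding F_diff(1)[OF xy]
      by (rule T(4)[OF _ F_diff(2)[OF xy]]) (use diff(2)[OF xy] in blast)
    finally show "(1/2) ^ j * (norm (x - y) - 2 * \<sigma> j) \<le> 16 * norm (F x - F y)" by simp
  qed
qed

theorem theorem1p8:
  fixes M :: "'a::banach set"
  assumes "\<not> fin_dim (UNIV :: 'a set)"
    and "\<not> fin_dim (UNIV :: 'b::banach set)"
    and "crudely_fin_rep_in_cof (UNIV :: 'a set) (UNIV :: 'b set)"
    and "proper_metric (submetric euclidean_metric M)"
  shows "almost_bilipschitz_embeddable (submetric euclidean_metric M)
           (euclidean_metric :: 'b metric)"
proof -
  obtain C where C: "C > 1" "\<And>Z. Z \<in> cof (UNIV :: 'b set) \<Longrightarrow> crudely_fin_rep C (UNIV :: 'a set) Z"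
    using assms(3) by (auto simp: crudely_fin_rep_in_cof_def)
  have M: "compact (M \<inter> cball 0 R)" for R
    by (rule proper_metric_compact_Int_cball[OF assms(4)])
  have embed: "\<exists>f :: 'a \<Rightarrow> 'b. \<forall>x\<in>M. \<forall>y\<in>M. \<phi> (dist x y) * (1/32) * dist x y \<le> dist (f x) (f y)
      \<and> dist (f x) (f y) \<le> (1536 * C) * (1/32) * dist x y + A"
    if A: "A > 0" and \<phi>: "continuous_on {0..} \<phi>" "\<phi> ` {0..} \<subseteq> {0..<1}" "\<phi> 0 = 0" for A \<phi>
  proof -
    have range: "0 \<le> \<phi> t" "\<phi> t \<le> 1" if "t \<ge> 0" for t
      using \<phi>(2) that by (force simp: image_subset_iff)+
    \<comment> \<open>The additive error \<open>48 * C * (2 * s)\<close> of the embedding becomes \<open>A\<close>.\<close>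
    define s where "s = A / (96 * C)"
    have s: "s > 0" using A C(1) by (simp add: s_def)
    obtain \<sigma> :: "nat \<Rightarrow> real" where \<sigma>: "\<forall>j. 0 < \<sigma> j \<and> \<sigma> j \<le> s"
      "\<forall>t>0. \<exists>j. 4 * \<sigma> j \<le> t \<and> \<phi> t \<le> (1/2) ^ j"
      by (rule scales_for_modulus[OF \<phi>(1,3) range(2) s])
    have C0: "C > 0" using C(1) by simp
    obtain F :: "'a \<Rightarrow> 'b" where
      F: "\<forall>x\<in>M. \<forall>y\<in>M. norm (F x - F y) \<le> 48 * C * (norm (x - y) + 2 * s)"
      "\<forall>x\<in>M. \<forall>y\<in>M. \<forall>j. (1/2) ^ j * (norm (x - y) - 2 * \<sigma> j) \<le> 16 * norm (F x - F y)"
      by (rule multiscale_embedding[OF C0 C(2) M \<sigma>(1)])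
    show ?thesis
    proof (intro exI[of _ F] ballI conjI)
      fix x y assume xy: "x \<in> M" "y \<in> M"
      have "48 * C * (2 * s) = A" using C(1) by (simp add: s_def)
      then show "dist (F x) (F y) \<le> (1536 * C) * (1/32) * dist x y + A"
        using F(1) xy by (simp add: dist_norm algebra_simps)
      show "\<phi> (dist x y) * (1/32) * dist x y \<le> dist (F x) (F y)"
      proof (cases "x = y")
        case False
        then obtain j where j: "4 * \<sigma> j \<le> dist x y" "\<phi> (dist x y) \<le> (1/2) ^ j"
          using \<sigma>(2) by (metis zero_less_dist_iff)
        \<comment> \<open>As \<open>4 * \<sigma> j \<le> dist x y\<close>, rounding to the net costs at most half of the distance. With the
          factor \<open>16\<close> of the embedding this gives the scaling \<open>1/32\<close>.\<close>
        have "\<phi> (dist x y) * (dist x y / 2) \<le> (1/2) ^ j * (norm (x - y) - 2 * \<sigma> j)"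
          using j by (intro mult_mono) (auto simp: dist_norm)
        then show ?thesis using F(2)[rule_format, OF xy, of j] by (simp add: dist_norm)
      qed simp
    qed
  qed
  show ?thesis
    unfolding almost_bilipschitz_embeddable_def
    by (intro allI impI, rule exI[of _ "1/32"], rule exI[of _ "1536 * C"]) (use embed C(1) in simp)
qed

end
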